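(* Let $(R,M)$ be a finite chain ring with Loewy length $n$. Let $X_1,X_2,\ldots$ be independent and identically distributed random variables, each uniformly distributed on the set $\{0,1,\ldots,n\}$, and let $S_k=X_1+\cdots+X_k$. Then, for every integer $k\ge 2$, $$\zeta_k(R)=\Pr(S_k\ge n).$$
   Context: A finite chain ring $(R,M)$ is a finite (nonzero) commutative ring with identity whose ideals are linearly ordered by inclusion; $M$ denotes its unique maximal ideal. Its Loewy length is the smallest positive integer $n$ with $M^n=(0)$. For a finite commutative ring $R$, let $\mathcal I(R)$ denote the set of all ideals of $R$. For an integer $k\ge 2$, the ideal zero-product probability is $$\zeta_k(R)=\frac{|\{(I_1,\ldots,I_k)\in\mathcal I(R)^k : I_1I_2\cdots I_k=(0)\}|}{|\mathcal I(R)|^k},$$ where $I_1\cdots I_k$ is the usual product of ideals. *)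

theory Defs
  imports "HOL-Probability.Probability" "HOL-Algebra.Ideal_Product"
begin

locale finite_chain_ring = cring R for R (structure) +
  fixes M
  assumes finite_carrier: "finite (carrier R)"
    and nonzero: "\<one> \<noteq> \<zero>"
    and ideals_chain: "\<lbrakk>ideal I R; ideal J R\<rbrakk> \<Longrightarrow> I \<subseteq> J \<or> J \<subseteq> I"
    and maximal: "maximalideal M R"

text \<open>Uniqueness of the maximal ideal need not be assumed: it follows from the chain condition.\<close>

lemma (in finite_chain_ring) maximalideal_unique:
  assumes N: "maximalideal N R"
  shows "N = M"
proof -
  interpret M: maximalideal M R by (rule maximal)
  interpret N: maximalideal N R by (rule N)
  from ideals_chain[OF M.ideal_axioms N.ideal_axioms] show ?thesis
  proof
    assume "M \<subseteq> N"
    with M.I_maximal[OF N.ideal_axioms] N.a_subset N.I_notcarr show ?thesis by auto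
  next
    assume "N \<subseteq> M"
    with N.I_maximal[OF M.ideal_axioms] M.a_subset M.I_notcarr show ?thesis by auto
  qed
qed

text \<open>The multiplication of \<open>ideals_set R\<close> is the product of ideals, with unit \<open>carrier R\<close>;
  so powers and finite products of ideals are \<open>[^]\<close> and \<open>finprod\<close> in that commutative monoid.\<close>

definition loewy_length :: "('a, 'b) ring_scheme \<Rightarrow> 'a set \<Rightarrow> nat" where
  "loewy_length R M = (LEAST n. 0 < n \<and> M [^]\<^bsub>ideals_set R\<^esub> n = {\<zero>\<^bsub>R\<^esub>})"

text \<open>A \<open>k\<close>-tuple of ideals is an extensional function on \<open>{1..k}\<close>.\<close>

definition ideal_zero_product_prob :: "nat \<Rightarrow> ('a, 'b) ring_scheme \<Rightarrow> real" where
  "ideal_zero_product_prob k R =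
     real (card {I \<in> {1..k} \<rightarrow>\<^sub>E {J. ideal J R}.
                  (\<Otimes>\<^bsub>ideals_set R\<^esub>i\<in>{1..k}. I i) = {\<zero>\<^bsub>R\<^esub>}})
     / real (card {J. ideal J R}) ^ k"

end

theory Submission
  imports Defs
begin

text \<open>In a finite chain ring every ideal is a power of the maximal ideal \<open>M\<close>: as \<open>M\<close> is generated
  by one element \<open>p\<close>, a nonzero ideal lying in \<open>M\<^sup>i\<close> but not in \<open>M\<^sup>i\<^sup>+\<^sup>1\<close> contains \<open>p\<^sup>i\<close>. The powers
  \<open>M\<^sup>0, \<dots>, M\<^sup>n\<close> are distinct, so exponents identify \<open>k\<close>-tuples of ideals with \<open>k\<close>-tuples in
  \<open>{0..n}\<close>, and a product of ideals vanishes iff the exponents add up to at least \<open>n\<close>.\<close>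

section \<open>Auxiliary facts on tuples and ideals\<close>

text \<open>Used to pass from coding single ideals by exponents to coding tuples. Restricting to
  \<open>I\<close> keeps the image extensional, so the coordinatewise inverse is exact.\<close>

lemma bij_betw_PiE_compose:
  assumes h: "bij_betw h A B"
  shows "bij_betw (\<lambda>f. \<lambda>i\<in>I. h (f i)) (I \<rightarrow>\<^sub>E A) (I \<rightarrow>\<^sub>E B)"
proof (rule bij_betw_byWitness[where f' = "\<lambda>g. \<lambda>i\<in>I. inv_into A h (g i)"])
  have inv: "h (inv_into A h b) = b" "inv_into A h b \<in> A" if "b \<in> B" for b
    using h that by (auto simp: bij_betw_def f_inv_into_f intro: inv_into_into)
  have inv': "inv_into A h (h a) = a" "h a \<in> B" if "a \<in> A" for a
    using h that by (auto simp: bij_betw_def inv_into_f_f)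
  show "\<forall>f\<in>I \<rightarrow>\<^sub>E A. (\<lambda>i\<in>I. inv_into A h ((\<lambda>i\<in>I. h (f i)) i)) = f"
    using inv' by (auto simp: PiE_iff extensional_def fun_eq_iff)
  show "\<forall>g\<in>I \<rightarrow>\<^sub>E B. (\<lambda>i\<in>I. h ((\<lambda>i\<in>I. inv_into A h (g i)) i)) = g"
    using inv by (auto simp: PiE_iff extensional_def fun_eq_iff)
  show "(\<lambda>f. \<lambda>i\<in>I. h (f i)) ` (I \<rightarrow>\<^sub>E A) \<subseteq> I \<rightarrow>\<^sub>E B"
    using inv' by (auto simp: PiE_iff)
  show "(\<lambda>g. \<lambda>i\<in>I. inv_into A h (g i)) ` (I \<rightarrow>\<^sub>E B) \<subseteq> I \<rightarrow>\<^sub>E A"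
    using inv by (auto simp: PiE_iff)
qed

lemma (in cring) ideal_prod_cgenideal:
  assumes "a \<in> carrier R" "b \<in> carrier R"
  shows "ideal_prod R (PIdl a) (PIdl b) = PIdl (a \<otimes> b)"
proof
  have id: "ideal (PIdl (a \<otimes> b)) R"
    using assms by (simp add: cgenideal_ideal)
  show "ideal_prod R (PIdl a) (PIdl b) \<subseteq> PIdl (a \<otimes> b)"
    using assms id
    by (simp add: ideal_prod_eq_genideal cgenideal_ideal cgenideal_prod genideal_minimal)
  show "PIdl (a \<otimes> b) \<subseteq> ideal_prod R (PIdl a) (PIdl b)"
    using assms
    by (intro cgenideal_minimal ideal_prod_is_ideal cgenideal_ideal ideal_prod.prod cgenideal_self)
qed

text \<open>The colon ideal (I : a). It contains \<open>\<one>\<close> exactly when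
  \<open>a \<in> I\<close>, so membership of \<open>a\<close> can be shown by proving this ideal to
  be the whole ring.\<close>

lemma (in cring) ideal_colon_element:
  assumes "ideal I R" "a \<in> carrier R"
  shows "ideal {r \<in> carrier R. r \<otimes> a \<in> I} R"
proof -
  interpret I: ideal I R by fact
  show ?thesis
  proof (intro idealI[OF ring_axioms] add.subgroupI)
    show "{r \<in> carrier R. r \<otimes> a \<in> I} \<noteq> {}"
      using assms by (auto intro!: exI[of _ "\<zero>"])
  qed (use assms in \<open>auto simp: l_distr m_assoc l_minus I.I_l_closed I.a_inv_closed a_inv_def[symmetric]\<close>,
      metis I.I_l_closed m_assoc m_comm)
qed

section \<open>Powers of the maximal ideal\<close>

context finite_chain_ring
begin

interpretation ideals: comm_monoid "ideals_set R"
  by (rule ideals_set_is_comm_monoid)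

abbreviation Mpow :: "nat \<Rightarrow> 'a set" where
  "Mpow i \<equiv> M [^]\<^bsub>ideals_set R\<^esub> i"

lemma M_ideal: "ideal M R"
  using maximal by (rule maximalideal.axioms)

lemma M_carrier: "M \<in> carrier (ideals_set R)"
  by (simp add: ideals_set_def M_ideal)

lemma Mpow_ideal: "ideal (Mpow i) R"
  using ideals.nat_pow_closed[OF M_carrier, of i] by (simp add: ideals_set_def)

text \<open>The chain condition forces \<open>M \<subseteq> I\<close>, and maximality leaves only
  the whole ring. This takes the place of inverting elements outside \<open>M\<close>.\<close>

lemma ideal_eq_carrier:
  assumes "ideal I R" "\<not> I \<subseteq> M"
  shows "I = carrier R"
  using ideals_chain[OF assms(1) M_ideal] maximalideal.I_maximal[OF maximal assms(1)] assms
  by (metis ideal.Icarr subset_eq)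

lemma one_notin_M: "\<one> \<notin> M"
  using M_ideal ideal.one_imp_carrier maximalideal.I_notcarr[OF maximal] by metis

lemma finite_ideal: "ideal I R \<Longrightarrow> finite I"
  using finite_carrier by (meson finite_subset ideal.Icarr subsetI)

text \<open>Among the finitely many principal ideals generated by elements of \<open>I\<close>, a
  maximal one is the largest by the chain condition, hence contains every element of
  \<open>I\<close>.\<close>

lemma ideal_principal:
  assumes I: "ideal I R"
  obtains a where "a \<in> carrier R" "I = PIdl a"
proof -
  have fin: "finite (cgenideal R ` I)" and ne: "cgenideal R ` I \<noteq> {}"
    using finite_ideal[OF I] additive_subgroup.zero_closed[OF ideal.axioms(1)[OF I]] by auto
  obtain a where a: "a \<in> I" and max: "\<And>b. b \<in> I \<Longrightarrow> PIdl a \<subseteq> PIdl b \<Longrightarrow> PIdl a = PIdl b"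
    using finite_has_maximal[OF fin ne] by (metis (no_types, lifting) imageE imageI)
  have carr: "\<And>b. b \<in> I \<Longrightarrow> b \<in> carrier R"
    using I by (rule ideal.Icarr)
  have "I \<subseteq> PIdl a"
  proof
    fix b assume b: "b \<in> I"
    have "PIdl b \<subseteq> PIdl a"
      using ideals_chain[OF cgenideal_ideal cgenideal_ideal, of a b] max[OF b] carr a b by auto
    then show "b \<in> PIdl a"
      using cgenideal_self[OF carr[OF b]] by auto
  qed
  then have "I = PIdl a"
    using cgenideal_minimal[OF I a] by auto
  then show thesis
    using that carr[OF a] by blast
qed

text \<open>One generator of \<open>M\<close> serves all exponents at once, since generators
  multiply along with principal ideals.\<close>

lemma Mpow_principal: "\<exists>p\<in>carrier R. \<forall>i::nat. Mpow i = PIdl (p [^] i)"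
proof -
  obtain p where p: "p \<in> carrier R" "M = PIdl p"
    using ideal_principal[OF M_ideal] .
  have "PIdl \<one> = carrier R"
    by (simp add: cgenideal_eq_genideal genideal_one)
  then have "Mpow i = PIdl (p [^] i)" for i :: nat
    by (induction i) (use p in \<open>simp_all add: ideals_set_def ideal_prod_cgenideal\<close>)
  with p(1) show ?thesis
    by blast
qed

lemma Mpow_zero: "Mpow 0 = carrier R"
  by (simp add: ideals_set_def)

lemma zero_in_ideal: "ideal I R \<Longrightarrow> {\<zero>} \<subseteq> I"
  using additive_subgroup.zero_closed ideal.axioms(1) by blast

lemma Mpow_Suc_subset: "Mpow (Suc i) \<subseteq> Mpow i"
  using ideal_prod_inter[OF Mpow_ideal M_ideal] by (auto simp: ideals_set_def)

lemma Mpow_antimono: "i \<le> j \<Longrightarrow> Mpow j \<subseteq> Mpow i"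
  using Mpow_Suc_subset by (rule lift_Suc_antimono_le)

text \<open>The instance of Nakayama's lemma needed here: if \<open>p\<^sup>i = r p\<^sup>i\<^sup>+\<^sup>1\<close> then \<open>1 - r p\<close> annihilates
  \<open>p\<^sup>i\<close>, and it lies outside \<open>M\<close>, so that the annihilator of \<open>p\<^sup>i\<close> is all of \<open>R\<close>.\<close>
lemma Mpow_stable_imp_zero:
  assumes "Mpow (Suc i) = Mpow i"
  shows "Mpow i = {\<zero>}"
proof -
  obtain p where p: "p \<in> carrier R" and Mp: "\<And>i::nat. Mpow i = PIdl (p [^] i)"
    using Mpow_principal by blast
  have pi: "p [^] i \<in> carrier R"
    using p by simp
  have "p [^] i \<in> PIdl (p [^] Suc i)"
    using assms cgenideal_self[OF pi] by (simp only: Mp)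
  then obtain r where r: "r \<in> carrier R" "p [^] i = r \<otimes> p [^] Suc i"
    unfolding cgenideal_def by blast
  define u where "u = \<one> \<ominus> r \<otimes> p"
  have u: "u \<in> carrier R"
    using p r by (simp add: u_def)
  have "u \<otimes> p [^] i = p [^] i \<ominus> r \<otimes> (p [^] i \<otimes> p)"
    unfolding u_def using p r(1) pi by algebra
  also have "\<dots> = \<zero>"
    using r(2) pi by (simp add: a_minus_def r_neg)
  finally have ann: "u \<otimes> p [^] i = \<zero>" .
  have "M = PIdl p"
    using Mp[of 1] ideals.l_one[OF M_carrier] p by simp
  then have "r \<otimes> p \<in> M"
    using r(1) by (auto simp: cgenideal_def)
  moreover have "\<one> = u \<oplus> r \<otimes> p"
    unfolding u_def using p r(1) by algebra
  ultimately have "u \<notin> M"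
    using one_notin_M additive_subgroup.a_closed[OF ideal.axioms(1)[OF M_ideal]] by metis
  then have "\<not> {x \<in> carrier R. x \<otimes> p [^] i \<in> {\<zero>}} \<subseteq> M"
    using u ann by auto
  then have "{x \<in> carrier R. x \<otimes> p [^] i \<in> {\<zero>}} = carrier R"
    using ideal_colon_element[OF zeroideal pi] ideal_eq_carrier by blast
  then have "\<one> \<otimes> p [^] i = \<zero>"
    using one_closed by blast
  then have "p [^] i = \<zero>"
    using pi by simp
  then show ?thesis
    by (simp add: Mp cgenideal_eq_genideal genideal_zero)
qed

section \<open>Loewy length and classification of the ideals\<close>

text \<open>Otherwise no power is stable, and the cardinalities of the powers descend strictly
  forever.\<close>

lemma ex_Mpow_eq_zero: "\<exists>i. Mpow i = {\<zero>}"
proof (rule ccontr)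
  assume "\<nexists>i. Mpow i = {\<zero>}"
  then have "Mpow (Suc i) \<subset> Mpow i" for i
    using Mpow_Suc_subset Mpow_stable_imp_zero by blast
  then have "card (Mpow (Suc i)) < card (Mpow i)" for i
    using finite_ideal[OF Mpow_ideal] by (simp add: psubset_card_mono)
  then have "\<exists>f :: nat \<Rightarrow> nat. \<forall>i. (f (Suc i), f i) \<in> {(x, y). x < y}"
    by (intro exI[of _ "\<lambda>i. card (Mpow i)"] allI CollectI case_prodI)
  then show False
    using wf_iff_no_infinite_down_chain[THEN iffD1, OF wf_less] by (rule rev_notE)
qed

lemma loewy_length_spec: "0 < loewy_length R M" "Mpow (loewy_length R M) = {\<zero>}"
proof -
  obtain i where "Mpow i = {\<zero>}"
    using ex_Mpow_eq_zero by blast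
  \<comment> \<open>The successor secures the positivity demanded in
    \<open>loewy_length\<close>.\<close>
  then have "0 < Suc i \<and> Mpow (Suc i) = {\<zero>}"
    using Mpow_Suc_subset[of i] zero_in_ideal[OF Mpow_ideal[of "Suc i"]] by auto
  then have "0 < loewy_length R M \<and> Mpow (loewy_length R M) = {\<zero>}"
    unfolding loewy_length_def by (rule LeastI)
  then show "0 < loewy_length R M" "Mpow (loewy_length R M) = {\<zero>}"
    by auto
qed

lemma Mpow_eq_zero_iff: "Mpow i = {\<zero>} \<longleftrightarrow> loewy_length R M \<le> i"
proof
  assume zero: "Mpow i = {\<zero>}"
  \<comment> \<open>\<open>Mpow 0\<close> is the whole ring and contains \<open>\<one>\<close>,
    which differs from \<open>\<zero>\<close>.\<close>
  have "i \<noteq> 0"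
    using zero nonzero one_closed Mpow_zero by (metis singletonD)
  then show "loewy_length R M \<le> i"
    unfolding loewy_length_def using zero by (intro Least_le) simp
next
  assume "loewy_length R M \<le> i"
  then show "Mpow i = {\<zero>}"
    using Mpow_antimono loewy_length_spec(2) zero_in_ideal[OF Mpow_ideal[of i]]
    by (metis subset_antisym)
qed

text \<open>A coincidence of the powers \<open>i < j\<close> would squeeze
  \<open>Mpow (Suc i)\<close> to equal \<open>Mpow i\<close>, which would then vanish below the
  Loewy length.\<close>

lemma inj_on_Mpow: "inj_on Mpow {0..loewy_length R M}"
proof (rule linorder_inj_onI)
  fix i j assume "i < j" "i \<in> {0..loewy_length R M}" "j \<in> {0..loewy_length R M}"
  then have "Mpow j \<subseteq> Mpow (Suc i)" "Mpow i \<noteq> {\<zero>}"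
    using Mpow_antimono[of "Suc i" j] by (simp_all add: Mpow_eq_zero_iff del: nat_pow_Suc)
  then show "Mpow i \<noteq> Mpow j"
    using Mpow_stable_imp_zero Mpow_Suc_subset by blast
qed auto

lemma ideal_eq_Mpow:
  assumes I: "ideal I R"
  shows "\<exists>i \<le> loewy_length R M. I = Mpow i"
proof (cases "I = {\<zero>}")
  case True
  then show ?thesis
    using loewy_length_spec(2) by auto
next
  case False
  define n where "n = loewy_length R M"
  have "\<not> I \<subseteq> Mpow n"
    using loewy_length_spec(2) False zero_in_ideal[OF I] by (auto simp: n_def)
  moreover have "I \<subseteq> Mpow 0"
    using I ideal.Icarr by (auto simp only: Mpow_zero)
  \<comment> \<open>Non-inclusion holds at \<open>n\<close> and fails at 0, so downward induction
    must break at some \<open>i\<close>.\<close>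
  ultimately obtain i where i: "i < n" "I \<subseteq> Mpow i" "\<not> I \<subseteq> Mpow (Suc i)"
    using inc_induct[of 0 n "\<lambda>i. \<not> I \<subseteq> Mpow i"] by blast
  obtain p where p: "p \<in> carrier R" and Mp: "\<And>i::nat. Mpow i = PIdl (p [^] i)"
    using Mpow_principal by blast
  have pi: "p [^] i \<in> carrier R"
    using p by simp
  \<comment> \<open>If \<open>J\<close> lay in \<open>M\<close>, all coefficients of elements of
    \<open>I\<close> over \<open>p [^] i\<close> would be in \<open>M\<close>, putting
    \<open>I\<close> inside \<open>Mpow (Suc i)\<close>.\<close>
  define J where "J = {r \<in> carrier R. r \<otimes> p [^] i \<in> I}"
  have "\<not> J \<subseteq> M"
  proof
    assume JM: "J \<subseteq> M"
    have "I \<subseteq> Mpow (Suc i)"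
    proof
      fix x assume x: "x \<in> I"
      then have "x \<in> PIdl (p [^] i)"
        using i(2) Mp by blast
      then obtain r where r: "r \<in> carrier R" "x = r \<otimes> p [^] i"
        unfolding cgenideal_def by blast
      then have "r \<in> M"
        using x JM by (auto simp: J_def)
      then have "p [^] i \<otimes> r \<in> ideal_prod R (Mpow i) M"
        using cgenideal_self[OF pi] by (intro ideal_prod.prod) (simp_all only: Mp)
      then show "x \<in> Mpow (Suc i)"
        using r pi by (simp add: ideals_set_def m_comm)
    qed
    with i(3) show False ..
  qed
  then have "J = carrier R"
    using ideal_eq_carrier ideal_colon_element[OF I pi] unfolding J_def by blast
  then have "\<one> \<in> J"
    by simp
  then have "p [^] i \<in> I"
    using pi by (simp add: J_def)
  then have "Mpow i \<subseteq> I"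
    unfolding Mp by (rule cgenideal_minimal[OF I])
  with i show ?thesis
    by (intro exI[of _ i]) (auto simp: n_def)
qed

section \<open>Counting tuples of ideals by exponents\<close>

lemma bij_betw_Mpow: "bij_betw Mpow {0..loewy_length R M} {I. ideal I R}"
  unfolding bij_betw_def using inj_on_Mpow ideal_eq_Mpow Mpow_ideal by fastforce

lemma finprod_Mpow:
  "finite A \<Longrightarrow> (\<Otimes>\<^bsub>ideals_set R\<^esub>i\<in>A. Mpow (f i)) = Mpow (\<Sum>i\<in>A. f i)"
  by (induction rule: finite_induct) (simp_all add: M_carrier Pi_def ideals.nat_pow_mult)

lemma card_ideal_tuples_zero_product:
  fixes k :: nat
  shows "card {I \<in> {1..k} \<rightarrow>\<^sub>E {J. ideal J R}. (\<Otimes>\<^bsub>ideals_set R\<^esub>i\<in>{1..k}. I i) = {\<zero>}} =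
   card {f \<in> {1..k} \<rightarrow>\<^sub>E {0..loewy_length R M}. loewy_length R M \<le> (\<Sum>i = 1..k. f i)}"
    (is "card ?S = card ?T")
proof -
  have "(\<Otimes>\<^bsub>ideals_set R\<^esub>i\<in>{1..k}. (\<lambda>i\<in>{1..k}. Mpow (f i)) i) = Mpow (\<Sum>i = 1..k. f i)"
    for f :: "nat \<Rightarrow> nat"
  proof -
    have "(\<Otimes>\<^bsub>ideals_set R\<^esub>i\<in>{1..k}. (\<lambda>i\<in>{1..k}. Mpow (f i)) i) =
        (\<Otimes>\<^bsub>ideals_set R\<^esub>i\<in>{1..k}. Mpow (f i))"
      by (rule ideals.finprod_cong') (auto simp: M_carrier)
    then show ?thesis
      by (simp add: finprod_Mpow)
  qed
  \<comment> \<open>The bijection of all tuples restricts to the two solution sets because the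
    conditions correspond under it.\<close>
  then have "bij_betw (\<lambda>f. \<lambda>i\<in>{1..k}. Mpow (f i)) ?T ?S"
    by (intro bij_betw_Collect bij_betw_PiE_compose bij_betw_Mpow) (simp only: Mpow_eq_zero_iff)
  then show ?thesis
    by (simp add: bij_betw_same_card)
qed

lemma ideal_zero_product_prob_eq:
  "ideal_zero_product_prob k R =
    card {f \<in> {1..k} \<rightarrow>\<^sub>E {0..loewy_length R M}. loewy_length R M \<le> (\<Sum>i = 1..k. f i)}
    / real (card {0..loewy_length R M}) ^ k"
  unfolding ideal_zero_product_prob_def card_ideal_tuples_zero_product
    bij_betw_same_card[OF bij_betw_Mpow] ..

end

section \<open>Independent uniform variables\<close>

text \<open>By independence each tuple over \<open>A\<close> is observed with the same probability.
  Up to a null set, the event is the disjoint union over the tuples satisfying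
  \<open>Q\<close>.\<close>

lemma (in prob_space) prob_indep_uniform:
  assumes indep: "indep_vars (\<lambda>_. count_space UNIV) X I"
    and I: "finite I" "I \<noteq> {}"
    and A: "finite A" "A \<noteq> {}"
    and unif: "\<And>i. i \<in> I \<Longrightarrow> distr M (count_space UNIV) (X i) = measure_pmf (pmf_of_set A)"
    and Q: "{\<omega> \<in> space M. Q (\<lambda>i\<in>I. X i \<omega>)} \<in> events"
  shows "\<P>(\<omega> in M. Q (\<lambda>i\<in>I. X i \<omega>)) = card {f \<in> I \<rightarrow>\<^sub>E A. Q f} / card A ^ card I"
proof -
  have rv[measurable]: "X i \<in> measurable M (count_space UNIV)" if "i \<in> I" for i
    using indep that by (simp add: indep_vars_def)
  define T where "T = {f \<in> I \<rightarrow>\<^sub>E A. Q f}"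
  \<comment> \<open>The event that \<open>f\<close> is observed; as \<open>I\<close> is nonempty, it
    lies in \<open>space M\<close>.\<close>
  define E where "E f = (\<Inter>i\<in>I. X i -` {f i} \<inter> space M)" for f
  have fin: "finite T"
    unfolding T_def using finite_PiE[OF I(1), of "\<lambda>_. A"] A(1) by simp
  have meas: "X i -` B \<inter> space M \<in> events" if "i \<in> I" for i B
    using measurable_sets[OF rv[OF that]] by simp
  have E: "E f \<in> events" for f
    unfolding E_def using I meas by (intro sets.finite_INT) auto
  have pX: "prob (X i -` B \<inter> space M) = measure (measure_pmf (pmf_of_set A)) B" if "i \<in> I" for i B
    using measure_distr[OF rv[OF that], of B] unif[OF that] by simp
  have pE: "prob (E f) = 1 / card A ^ card I" if "f \<in> T" for f
  proof -
    have "prob (E f) = (\<Prod>i\<in>I. prob (X i -` {f i} \<inter> space M))"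
      unfolding E_def using indep I by (intro indep_varsD_finite) auto
    also have "\<dots> = (\<Prod>i\<in>I. 1 / card A)"
      using that A by (intro prod.cong) (auto simp: pX T_def measure_pmf_of_set PiE_iff Int_absorb1)
    finally show ?thesis
      by (simp add: power_divide)
  qed
  have disj: "disjoint_family_on E T"
  proof (unfold disjoint_family_on_def, intro ballI impI)
    fix f g assume "f \<in> T" "g \<in> T" "f \<noteq> g"
    \<comment> \<open>Distinct extensional functions differ at an index inside
      \<open>I\<close>.\<close>
    then obtain i where "i \<in> I" "f i \<noteq> g i"
      unfolding T_def by (metis (mono_tags, lifting) PiE_ext mem_Collect_eq)
    then show "E f \<inter> E g = {}"
      by (auto simp: E_def)
  qed
  \<comment> \<open>The law only says that values outside \<open>A\<close> have probability zero, so
    the decomposition below holds almost everywhere.\<close>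
  have "AE \<omega> in M. X i \<omega> \<in> A" if "i \<in> I" for i
  proof -
    have "prob (X i -` A \<inter> space M) = 1"
      using A pX[OF that, of A] by (simp add: measure_pmf_of_set)
    then have "AE \<omega> in M. \<omega> \<in> X i -` A \<inter> space M"
      using meas[OF that] by (simp only: prob_eq_1)
    then show ?thesis
      by eventually_elim auto
  qed
  then have AE: "AE \<omega> in M. \<forall>i\<in>I. X i \<omega> \<in> A"
    using I by (simp add: AE_ball_countable countable_finite)
  have Un: "(\<Union>f\<in>T. E f) = {\<omega> \<in> space M. Q (\<lambda>i\<in>I. X i \<omega>) \<and> (\<forall>i\<in>I. X i \<omega> \<in> A)}"
  proof (intro equalityI subsetI)
    fix \<omega> assume "\<omega> \<in> (\<Union>f\<in>T. E f)"
    then obtain f where f: "f \<in> T" "\<omega> \<in> E f"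
      by blast
    then have eq: "\<And>i. i \<in> I \<Longrightarrow> X i \<omega> = f i" and sp: "\<omega> \<in> space M"
      using I by (auto simp: E_def)
    then have "(\<lambda>i\<in>I. X i \<omega>) = f"
      using f by (auto simp: T_def PiE_iff extensional_def)
    with f eq sp show "\<omega> \<in> {\<omega> \<in> space M. Q (\<lambda>i\<in>I. X i \<omega>) \<and> (\<forall>i\<in>I. X i \<omega> \<in> A)}"
      by (auto simp: T_def)
  next
    fix \<omega> assume "\<omega> \<in> {\<omega> \<in> space M. Q (\<lambda>i\<in>I. X i \<omega>) \<and> (\<forall>i\<in>I. X i \<omega> \<in> A)}"
    then have "(\<lambda>i\<in>I. X i \<omega>) \<in> T" "\<omega> \<in> E (\<lambda>i\<in>I. X i \<omega>)"
      by (auto simp: T_def E_def)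
    then show "\<omega> \<in> (\<Union>f\<in>T. E f)"
      by blast
  qed
  have "\<P>(\<omega> in M. Q (\<lambda>i\<in>I. X i \<omega>)) = prob (\<Union>f\<in>T. E f)"
  proof (rule finite_measure_eq_AE)
    show "AE \<omega> in M. \<omega> \<in> {\<omega> \<in> space M. Q (\<lambda>i\<in>I. X i \<omega>)} \<longleftrightarrow> \<omega> \<in> (\<Union>f\<in>T. E f)"
      using AE unfolding Un by eventually_elim auto
  qed (use Q fin E in auto)
  also have "\<dots> = (\<Sum>f\<in>T. prob (E f))"
    using fin E disj by (intro finite_measure_finite_Union) auto
  also have "\<dots> = card T / card A ^ card I"
    by (simp add: pE)
  finally show ?thesis
    unfolding T_def .
qed

section \<open>Comparison of the two counts\<close>

theorem theorem8p1:
  fixes R :: "('a, 'b) ring_scheme" and M :: "'a set" and n k :: nat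
    and P :: "'w measure" and X :: "nat \<Rightarrow> 'w \<Rightarrow> nat"
  assumes "finite_chain_ring R M"
    and "n = loewy_length R M"
    and "prob_space P"
    and "prob_space.indep_vars P (\<lambda>_. count_space UNIV) X {1..}"
    and "\<And>i. 1 \<le> i \<Longrightarrow> distr P (count_space UNIV) (X i) = measure_pmf (pmf_of_set {0..n})"
    and "2 \<le> k"
  shows "ideal_zero_product_prob k R = \<P>(\<omega> in P. (\<Sum>i = 1..k. X i \<omega>) \<ge> n)"
proof -
  interpret finite_chain_ring R M by fact
  interpret P: prob_space P by fact
  have "P.indep_vars (\<lambda>_. count_space UNIV) X {1..k}"
    using assms(4) by (rule P.indep_vars_subset) auto
  note indep = this
  have rv: "X i \<in> measurable P (count_space UNIV)" if "i \<in> {1..k}" for i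
    using indep that by (simp add: P.indep_vars_def)
  \<comment> \<open>The sum is written through the restricted tuple to match the form of
    \<open>Q\<close> in \<open>prob_indep_uniform\<close>.\<close>
  have "(\<lambda>\<omega>. \<Sum>i = 1..k. (\<lambda>i\<in>{1..k}. X i \<omega>) i) \<in> measurable P (count_space UNIV)"
    using rv by (simp cong: sum.cong)
  then have "{\<omega> \<in> space P. n \<le> (\<Sum>i = 1..k. (\<lambda>i\<in>{1..k}. X i \<omega>) i)} \<in> P.events"
    by measurable
  from P.prob_indep_uniform[OF indep _ _ _ _ assms(5) this]
  have "\<P>(\<omega> in P. n \<le> (\<Sum>i = 1..k. X i \<omega>)) =
      card {f \<in> {1..k} \<rightarrow>\<^sub>E {0..n}. n \<le> (\<Sum>i = 1..k. f i)} / real (card {0..n}) ^ k"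
    \<comment> \<open>The bound on \<open>k\<close> makes the index set nonempty.\<close>
    using \<open>2 \<le> k\<close> by simp
  then show ?thesis
    by (simp only: ideal_zero_product_prob_eq assms(2))
qed

end
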